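(* Let $\ell\ge 2$, $r\ge 2$ and $t\ge 1$ be integers. Then there is a constant $c$ (independent of $m$) such that for all $m\ge 1$, $$\mathrm{forb}(m,r,t\cdot\mathcal{T}_\ell(r))\le 2r(r-1)(t-1)m+c.$$
   Context: An $r$-matrix is a matrix all of whose entries lie in $\{0,1,\ldots,r-1\}$. A matrix is simple if it has no repeated columns. For matrices $F,A$, write $F\prec A$ ($F$ is a configuration in $A$) if some row and column permutation of $F$ is a submatrix of $A$. $\|A\|$ is the number of columns of $A$. For a family $\mathcal{F}$ of matrices, $\mathrm{forb}(m,r,\mathcal{F})$ is the maximum of $\|A\|$ over all $m$-rowed simple $r$-matrices $A$ such that $F\nprec A$ for every $F\in\mathcal{F}$. For $a\ne b$, $I_\ell(a,b)$ is the $\ell\times\ell$ matrix with $a$'s on the diagonal and $b$'s elsewhere; $T_\ell(a,b)$ is the $\ell\times\ell$ matrix with $a$'s (strictly) below the diagonal and $b$'s elsewhere. Set $$\mathcal{T}_\ell(r)=\{I_\ell(a,b): a,b\in\{0,\ldots,r-1\},a\neq b\}\cup\{T_\ell(a,b): a,b\in\{0,\ldots,r-1\},a\neq b\}.$$ For a matrix $M$, $t\cdot M=[M|M|\cdots|M]$ is the concatenation of $t$ copies of $M$, and for a family $\mathcal{F}$, $t\cdot\mathcal{F}=\{t\cdot M: M\in\mathcal{F}\}$. *)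

theory Defs
  imports "Jordan_Normal_Form.DL_Submatrix" "HOL-Combinatorics.Permutations"
    "HOL-Library.FuncSet"
begin

text \<open>Rows and columns are indexed from 0, as usual for \<^typ>\<open>'a mat\<close>.\<close>

definition r_matrix :: "nat \<Rightarrow> nat mat \<Rightarrow> bool" where
  "r_matrix r A \<longleftrightarrow> elements_mat A \<subseteq> {0..<r}"

definition simple_mat :: "'a mat \<Rightarrow> bool" where
  "simple_mat A \<longleftrightarrow> distinct (cols A)"

definition permute_mat :: "(nat \<Rightarrow> nat) \<Rightarrow> (nat \<Rightarrow> nat) \<Rightarrow> 'a mat \<Rightarrow> 'a mat" where
  "permute_mat p q F = mat (dim_row F) (dim_col F) (\<lambda>(i, j). F $$ (p i, q j))"

text \<open>\<^const>\<open>submatrix\<close> keeps the selected rows and columns in their original order.\<close>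

definition configuration :: "'a mat \<Rightarrow> 'a mat \<Rightarrow> bool" (infix "\<prec>\<^sub>c" 50) where
  "F \<prec>\<^sub>c A \<longleftrightarrow> (\<exists>p q I J. p permutes {0..<dim_row F} \<and> q permutes {0..<dim_col F} \<and>
     I \<subseteq> {0..<dim_row A} \<and> J \<subseteq> {0..<dim_col A} \<and>
     submatrix A I J = permute_mat p q F)"

definition avoiding :: "nat \<Rightarrow> nat \<Rightarrow> nat mat set \<Rightarrow> nat mat set" where
  "avoiding m r \<F> =
     {A. dim_row A = m \<and> r_matrix r A \<and> simple_mat A \<and> (\<forall>F\<in>\<F>. \<not> F \<prec>\<^sub>c A)}"

text \<open>The maximum is over a finite set (\<open>finite_avoiding\<close>), which is nonempty as soon as every
  member of the family has at least one column (\<open>avoiding_nonempty\<close>); this includes all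
  families \<open>t \<cdot> \<T>\<^sub>\<ell>(r)\<close> with \<open>t, \<ell> \<ge> 1\<close>.\<close>

definition forb :: "nat \<Rightarrow> nat \<Rightarrow> nat mat set \<Rightarrow> nat" where
  "forb m r \<F> = Max (dim_col ` avoiding m r \<F>)"

definition I_mat :: "nat \<Rightarrow> 'a \<Rightarrow> 'a \<Rightarrow> 'a mat" where
  "I_mat l a b = mat l l (\<lambda>(i, j). if i = j then a else b)"

definition T_mat :: "nat \<Rightarrow> 'a \<Rightarrow> 'a \<Rightarrow> 'a mat" where
  "T_mat l a b = mat l l (\<lambda>(i, j). if j < i then a else b)"

definition T_family :: "nat \<Rightarrow> nat \<Rightarrow> nat mat set" where
  "T_family l r =
     {I_mat l a b | a b. a \<in> {0..<r} \<and> b \<in> {0..<r} \<and> a \<noteq> b} \<union>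
     {T_mat l a b | a b. a \<in> {0..<r} \<and> b \<in> {0..<r} \<and> a \<noteq> b}"

text \<open>Column \<open>j\<close> of \<open>[M|M|\<dots>|M]\<close> is column \<open>j mod \<parallel>M\<parallel>\<close> of \<open>M\<close>.\<close>

definition copies :: "nat \<Rightarrow> 'a mat \<Rightarrow> 'a mat" where
  "copies t M = mat (dim_row M) (t * dim_col M) (\<lambda>(i, j). M $$ (i, j mod dim_col M))"

definition copies_family :: "nat \<Rightarrow> 'a mat set \<Rightarrow> 'a mat set" where
  "copies_family t \<F> = copies t ` \<F>"

lemma finite_avoiding: "finite (avoiding m r \<F>)"
proof -
  let ?V = "vec m ` ({0..<m} \<rightarrow>\<^sub>E {0..<r})"
  have "finite ?V"
    by (intro finite_imageI finite_PiE) auto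
  moreover have "cols A \<in> {xs. set xs \<subseteq> ?V \<and> distinct xs}" if A: "A \<in> avoiding m r \<F>" for A
  proof -
    have "col A j \<in> ?V" if j: "j < dim_col A" for j
    proof (rule image_eqI)
      let ?f = "restrict (\<lambda>i. A $$ (i, j)) {0..<m}"
      show "col A j = vec m ?f"
        using A by (auto simp: avoiding_def col_def intro!: eq_vecI)
      show "?f \<in> {0..<m} \<rightarrow>\<^sub>E {0..<r}"
        using A j by (fastforce simp: avoiding_def r_matrix_def elements_mat_def)
    qed
    then show ?thesis
      using A by (auto simp: avoiding_def simple_mat_def cols_def)
  qed
  then have "cols ` avoiding m r \<F> \<subseteq> {xs. set xs \<subseteq> ?V \<and> distinct xs}"
    by blast
  moreover have "finite {xs. set xs \<subseteq> ?V \<and> distinct xs}"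
    using \<open>finite ?V\<close> by (rule finite_subset_distinct)
  moreover have "inj_on cols (avoiding m r \<F>)"
  proof (rule inj_onI)
    fix A B
    assume "A \<in> avoiding m r \<F>" "B \<in> avoiding m r \<F>" "cols A = cols B"
    then show "A = B"
      using mat_of_cols_cols[of A] mat_of_cols_cols[of B] by (auto simp: avoiding_def)
  qed
  ultimately show ?thesis
    using finite_subset finite_imageD by blast
qed

lemma avoiding_nonempty:
  assumes "\<And>F. F \<in> \<F> \<Longrightarrow> dim_col F > 0"
  shows "avoiding m r \<F> \<noteq> {}"
proof -
  have "\<not> F \<prec>\<^sub>c mat m 0 (\<lambda>_. 0)" if "F \<in> \<F>" for F
  proof
    assume "F \<prec>\<^sub>c mat m 0 (\<lambda>_. 0)"
    then obtain p q I J where "submatrix (mat m 0 (\<lambda>_. 0)) I J = permute_mat p q F"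
      by (auto simp: configuration_def)
    from arg_cong[OF this, of dim_col] have "dim_col F = 0"
      by (simp add: permute_mat_def dim_submatrix)
    then show False
      using assms[OF that] by simp
  qed
  then have "mat m 0 (\<lambda>_. 0) \<in> avoiding m r \<F>"
    by (auto simp: avoiding_def r_matrix_def elements_mat_def simple_mat_def cols_def)
  then show ?thesis
    by blast
qed

end

theory Submission
  imports Defs "HOL-Library.Ramsey"
begin

text \<open>
  The bound comes from deleting one row at a time. Deleting row \<open>i\<close> may make some columns equal;
  keep one column of each class of columns that have become equal and call the others lost.
  If at most \<open>2 r (r - 1) (t - 1)\<close> columns are lost for some row, delete that row and induct on the
  number of rows. The claim is that such a row exists as soon as the number of rows reaches a
  constant \<open>R\<close>; with fewer than \<open>R\<close> rows there are at most \<open>r ^ R\<close> columns, which is the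
  additive constant.

  For the claim, suppose that every row \<open>i\<close> loses more than \<open>2 r (r - 1) (t - 1)\<close> columns
  \<open>x\<^sub>i\<^sub>,\<^sub>k\<close>. Each of them has a twin \<open>y\<^sub>i\<^sub>,\<^sub>k\<close>, a kept column that differs from it in
  row \<open>i\<close> only. Colour a pair of rows \<open>i < j\<close> by the entries of all these columns in the rows \<open>i\<close>
  and \<open>j\<close>. Ramsey's theorem gives many rows on which, for every \<open>k\<close>, the column \<open>x\<^sub>i\<^sub>,\<^sub>k\<close> has a
  fixed symbol \<open>u\<^sub>k\<close> in the rows after \<open>i\<close> and a fixed symbol \<open>v\<^sub>k\<close> in the rows before \<open>i\<close>.
  If \<open>u\<^sub>k \<noteq> v\<^sub>k\<close>, using every other row and column of the resulting square hides the diagonal and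
  leaves \<open>T\<^sub>l(u\<^sub>k, v\<^sub>k)\<close>. If \<open>u\<^sub>k = v\<^sub>k\<close>, then \<open>x\<^sub>i\<^sub>,\<^sub>k\<close> or its twin has a
  symbol \<open>w\<^sub>k \<noteq> u\<^sub>k\<close> in row \<open>i\<close>, which gives \<open>I\<^sub>l(w\<^sub>k, u\<^sub>k)\<close>. So every index \<open>k\<close>
  yields one of the \<open>2 r (r - 1)\<close> members of the family, and \<open>t\<close> of the indices yield the same one
  (lemma \<open>twins_in_every_row\<close>).
\<close>

section \<open>Repeated patterns in a rectangular array\<close>

text \<open>Arrays are functions of a row and a column, restricted to a set of rows and a set of columns;
  in this form rows and columns can be dropped without renumbering the remaining ones.\<close>

definition agree_on :: "('a \<Rightarrow> 'b \<Rightarrow> 'c) \<Rightarrow> 'a set \<Rightarrow> 'b \<Rightarrow> 'b \<Rightarrow> bool" where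
  "agree_on A M x y \<longleftrightarrow> (\<forall>i\<in>M. A i x = A i y)"

definition simple_on :: "('a \<Rightarrow> 'b \<Rightarrow> 'c) \<Rightarrow> 'a set \<Rightarrow> 'b set \<Rightarrow> bool" where
  "simple_on A M X \<longleftrightarrow> (\<forall>x\<in>X. \<forall>y\<in>X. agree_on A M x y \<longrightarrow> x = y)"

definition repeated_in ::
    "nat \<Rightarrow> 'c mat \<Rightarrow> ('a \<Rightarrow> 'b \<Rightarrow> 'c) \<Rightarrow> 'a set \<Rightarrow> 'b set \<Rightarrow> bool" where
  "repeated_in t F A M X \<longleftrightarrow> (\<exists>\<rho> \<kappa>.
     \<rho> \<in> {..<dim_row F} \<rightarrow> M \<and> inj_on \<rho> {..<dim_row F} \<and>
     (\<forall>j<dim_col F. \<forall>k<t. \<kappa> j k \<in> X) \<and>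
     inj_on (\<lambda>(j, k). \<kappa> j k) ({..<dim_col F} \<times> {..<t}) \<and>
     (\<forall>i<dim_row F. \<forall>j<dim_col F. \<forall>k<t. A (\<rho> i) (\<kappa> j k) = F $$ (i, j)))"

lemma repeated_in_mono:
  assumes "repeated_in t F A M X" "M \<subseteq> M'" "X \<subseteq> X'"
  shows "repeated_in t F A M' X'"
proof -
  obtain \<rho> \<kappa> where *: "\<rho> \<in> {..<dim_row F} \<rightarrow> M" "inj_on \<rho> {..<dim_row F}"
    "\<forall>j<dim_col F. \<forall>k<t. \<kappa> j k \<in> X" "inj_on (\<lambda>(j, k). \<kappa> j k) ({..<dim_col F} \<times> {..<t})"
    "\<forall>i<dim_row F. \<forall>j<dim_col F. \<forall>k<t. A (\<rho> i) (\<kappa> j k) = F $$ (i, j)"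
    using assms(1) unfolding repeated_in_def by blast
  have "\<rho> \<in> {..<dim_row F} \<rightarrow> M'" "\<forall>j<dim_col F. \<forall>k<t. \<kappa> j k \<in> X'"
    using *(1,3) assms(2,3) by blast+
  with *(2,4,5) show ?thesis
    unfolding repeated_in_def by blast
qed

text \<open>If the columns of the pattern are distinct, then columns that realize different ones of them
  are distinct, and only the copies of the same column have to be told apart.\<close>

lemma repeated_inI:
  assumes \<rho>: "\<rho> \<in> {..<dim_row F} \<rightarrow> M" "inj_on \<rho> {..<dim_row F}"
    and \<kappa>: "\<And>j k. j < dim_col F \<Longrightarrow> k < t \<Longrightarrow> \<kappa> j k \<in> X"
    and inj: "\<And>j. j < dim_col F \<Longrightarrow> inj_on (\<kappa> j) {..<t}"
    and entries: "\<And>i j k. i < dim_row F \<Longrightarrow> j < dim_col F \<Longrightarrow> k < t \<Longrightarrow> A (\<rho> i) (\<kappa> j k) = F $$ (i, j)"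
    and F: "\<And>j j'. j < j' \<Longrightarrow> j' < dim_col F \<Longrightarrow> \<exists>i<dim_row F. F $$ (i, j) \<noteq> F $$ (i, j')"
  shows "repeated_in t F A M X"
proof -
  have "inj_on (\<lambda>(j, k). \<kappa> j k) ({..<dim_col F} \<times> {..<t})"
  proof (rule inj_onI, clarsimp)
    fix j k j' k'
    assume *: "j < dim_col F" "k < t" "j' < dim_col F" "k' < t" "\<kappa> j k = \<kappa> j' k'"
    have "F $$ (i, j) = F $$ (i, j')" if "i < dim_row F" for i
      using entries[OF that *(1,2)] entries[OF that *(3,4)] *(5) by simp
    then have "j = j'"
      using F[of j j'] F[of j' j] *(1,3) by (metis linorder_neqE_nat)
    with * inj[of j] show "j = j' \<and> k = k'"
      by (auto dest: inj_onD)
  qed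
  then show ?thesis
    unfolding repeated_in_def using \<rho> \<kappa> entries by blast
qed

lemma repeated_I_mat:
  assumes \<sigma>: "\<sigma> \<in> {..<l} \<rightarrow> M" "inj_on \<sigma> {..<l}" and "a \<noteq> b"
    and z: "\<And>p k. p < l \<Longrightarrow> k < t \<Longrightarrow> z p k \<in> X" "\<And>p. p < l \<Longrightarrow> inj_on (z p) {..<t}"
    and diag: "\<And>p k. p < l \<Longrightarrow> k < t \<Longrightarrow> A (\<sigma> p) (z p k) = a"
    and off: "\<And>p q k. p < l \<Longrightarrow> q < l \<Longrightarrow> p \<noteq> q \<Longrightarrow> k < t \<Longrightarrow> A (\<sigma> q) (z p k) = b"
  shows "repeated_in t (I_mat l a b) A M X"
proof (rule repeated_inI[of \<sigma> _ _ _ z])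
  fix j j' assume "j < j'" "j' < dim_col (I_mat l a b)"
  then show "\<exists>i<dim_row (I_mat l a b). I_mat l a b $$ (i, j) \<noteq> I_mat l a b $$ (i, j')"
    using \<open>a \<noteq> b\<close> by (intro exI[of _ j]) (auto simp: I_mat_def)
next
  fix i j k assume "i < dim_row (I_mat l a b)" "j < dim_col (I_mat l a b)" "k < t"
  then show "A (\<sigma> i) (z j k) = I_mat l a b $$ (i, j)"
    using diag[of j k] off[of j i k] by (auto simp: I_mat_def)
qed (use \<sigma> z in \<open>auto simp: I_mat_def\<close>)

text \<open>A square of size \<open>2 l\<close> that is constant on each side of its diagonal contains \<open>T\<^sub>l\<close>: taking
  the even rows and the odd columns avoids the diagonal, and column \<open>2 j + 1\<close> lies before row \<open>2 i\<close>
  exactly if \<open>j < i\<close>.\<close>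

lemma repeated_T_mat:
  assumes \<sigma>: "\<sigma> \<in> {..<2 * l} \<rightarrow> M" "inj_on \<sigma> {..<2 * l}" and "a \<noteq> b"
    and z: "\<And>p k. p < 2 * l \<Longrightarrow> k < t \<Longrightarrow> z p k \<in> X" "\<And>p. p < 2 * l \<Longrightarrow> inj_on (z p) {..<t}"
    and below: "\<And>p q k. p < q \<Longrightarrow> q < 2 * l \<Longrightarrow> k < t \<Longrightarrow> A (\<sigma> q) (z p k) = a"
    and above: "\<And>p q k. p < q \<Longrightarrow> q < 2 * l \<Longrightarrow> k < t \<Longrightarrow> A (\<sigma> p) (z q k) = b"
  shows "repeated_in t (T_mat l a b) A M X"
proof (rule repeated_inI[of "\<lambda>i. \<sigma> (2 * i)" _ _ _ "\<lambda>j. z (2 * j + 1)"])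
  fix j j' assume "j < j'" "j' < dim_col (T_mat l a b)"
  then show "\<exists>i<dim_row (T_mat l a b). T_mat l a b $$ (i, j) \<noteq> T_mat l a b $$ (i, j')"
    using \<open>a \<noteq> b\<close> by (intro exI[of _ j']) (auto simp: T_mat_def)
next
  fix i j k assume *: "i < dim_row (T_mat l a b)" "j < dim_col (T_mat l a b)" "k < t"
  show "A (\<sigma> (2 * i)) (z (2 * j + 1) k) = T_mat l a b $$ (i, j)"
  proof (cases "j < i")
    case True
    with * show ?thesis
      using below[of "2 * j + 1" "2 * i" k] by (auto simp: T_mat_def)
  next
    case False
    with * show ?thesis
      using above[of "2 * i" "2 * j + 1" k] by (auto simp: T_mat_def)
  qed
next
  show "inj_on (\<lambda>i. \<sigma> (2 * i)) {..<dim_row (T_mat l a b)}"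
  proof (rule inj_onI)
    fix i i' assume "i \<in> {..<dim_row (T_mat l a b)}" "i' \<in> {..<dim_row (T_mat l a b)}"
      and "\<sigma> (2 * i) = \<sigma> (2 * i')"
    then show "i = i'"
      using inj_onD[OF \<sigma>(2), of "2 * i" "2 * i'"] by (auto simp: T_mat_def)
  qed
qed (use \<sigma> z in \<open>auto simp: T_mat_def\<close>)

section \<open>Patterns in arrays and configurations in matrices\<close>

lemma pick_enumerates:
  fixes f :: "nat \<Rightarrow> nat"
  assumes "inj_on f {0..<n}"
  obtains p where "p permutes {0..<n}" "\<And>i. i < n \<Longrightarrow> f (p i) = pick (f ` {0..<n}) i"
proof -
  let ?S = "f ` {0..<n}" and ?g = "the_inv_into {0..<n} f"
  define p where "p i = (if i < n then ?g (pick ?S i) else i)" for i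
  have card: "card ?S = n"
    using assms by (simp add: card_image)
  have in_S: "pick ?S i \<in> ?S" if "i < n" for i
    using that card by (intro pick_in_set) simp
  have f_p: "f (p i) = pick ?S i" if "i < n" for i
    using that in_S f_the_inv_into_f[OF assms] by (simp add: p_def)
  have "inj_on p {0..<n}"
  proof (rule inj_onI)
    fix i j assume ij: "i \<in> {0..<n}" "j \<in> {0..<n}" "p i = p j"
    then have "pick ?S i = pick ?S j"
      using f_p by (metis atLeastLessThan_iff)
    then show "i = j"
      using ij pick_mono[of i ?S j] pick_mono[of j ?S i] card
      by (metis atLeastLessThan_iff less_irrefl linorder_neqE_nat pick_mono)
  qed
  moreover have "p ` {0..<n} \<subseteq> {0..<n}"
    using in_S the_inv_into_into[OF assms _ subset_refl] by (auto simp: p_def)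
  ultimately have "bij_betw p {0..<n} {0..<n}"
    by (simp add: bij_betw_def endo_inj_surj)
  then have "p permutes {0..<n}"
    by (rule bij_imp_permutes) (simp add: p_def)
  with f_p show ?thesis
    using that by blast
qed

lemma configurationI:
  assumes \<rho>: "\<rho> ` {0..<dim_row F} \<subseteq> {0..<dim_row A}" "inj_on \<rho> {0..<dim_row F}"
    and \<kappa>: "\<kappa> ` {0..<dim_col F} \<subseteq> {0..<dim_col A}" "inj_on \<kappa> {0..<dim_col F}"
    and entries: "\<And>i j. i < dim_row F \<Longrightarrow> j < dim_col F \<Longrightarrow> A $$ (\<rho> i, \<kappa> j) = F $$ (i, j)"
  shows "F \<prec>\<^sub>c A"
proof -
  let ?I = "\<rho> ` {0..<dim_row F}" and ?J = "\<kappa> ` {0..<dim_col F}"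
  obtain p where p: "p permutes {0..<dim_row F}" "\<And>i. i < dim_row F \<Longrightarrow> \<rho> (p i) = pick ?I i"
    using pick_enumerates[OF \<rho>(2)] by blast
  obtain q where q: "q permutes {0..<dim_col F}" "\<And>j. j < dim_col F \<Longrightarrow> \<kappa> (q j) = pick ?J j"
    using pick_enumerates[OF \<kappa>(2)] by blast
  have sets: "{i. i < dim_row A \<and> i \<in> ?I} = ?I" "{j. j < dim_col A \<and> j \<in> ?J} = ?J"
    using \<rho>(1) \<kappa>(1) by auto
  have dims: "card ?I = dim_row F" "card ?J = dim_col F"
    using \<rho>(2) \<kappa>(2) by (simp_all add: card_image)
  have "submatrix A ?I ?J = permute_mat p q F"
  proof (rule eq_matI)
    fix i j
    assume "i < dim_row (permute_mat p q F)" "j < dim_col (permute_mat p q F)"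
    then have ij: "i < dim_row F" "j < dim_col F"
      by (simp_all add: permute_mat_def)
    then have "p i < dim_row F" "q j < dim_col F"
      using permutes_in_image[OF p(1), of i] permutes_in_image[OF q(1), of j] by auto
    then have "A $$ (pick ?I i, pick ?J j) = F $$ (p i, q j)"
      using entries[of "p i" "q j"] p(2)[OF ij(1)] q(2)[OF ij(2)] by simp
    then show "submatrix A ?I ?J $$ (i, j) = permute_mat p q F $$ (i, j)"
      using ij by (simp add: submatrix_def permute_mat_def sets dims)
  qed (simp_all add: dim_submatrix permute_mat_def sets dims)
  with p(1) q(1) \<rho>(1) \<kappa>(1) show ?thesis
    unfolding configuration_def by blast
qed

lemma repeated_in_imp_configuration:
  assumes "repeated_in t F (\<lambda>i j. A $$ (i, j)) {0..<dim_row A} {0..<dim_col A}"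
  shows "copies t F \<prec>\<^sub>c A"
proof -
  let ?n = "dim_col F"
  obtain \<rho> \<kappa> where \<rho>: "\<rho> \<in> {..<dim_row F} \<rightarrow> {0..<dim_row A}" "inj_on \<rho> {..<dim_row F}"
    and \<kappa>: "\<And>j k. j < ?n \<Longrightarrow> k < t \<Longrightarrow> \<kappa> j k \<in> {0..<dim_col A}"
      "inj_on (\<lambda>(j, k). \<kappa> j k) ({..<?n} \<times> {..<t})"
    and entries: "\<And>i j k. i < dim_row F \<Longrightarrow> j < ?n \<Longrightarrow> k < t \<Longrightarrow>
      A $$ (\<rho> i, \<kappa> j k) = F $$ (i, j)"
    using assms unfolding repeated_in_def by blast
  have split: "j mod ?n < ?n \<and> j div ?n < t" if "j < t * ?n" for j
    using that by (cases "?n = 0") (auto simp: less_mult_imp_div_less)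
  show ?thesis
  proof (rule configurationI[of \<rho> _ _ "\<lambda>j. \<kappa> (j mod ?n) (j div ?n)"])
    show "inj_on (\<lambda>j. \<kappa> (j mod ?n) (j div ?n)) {0..<dim_col (copies t F)}"
    proof (rule inj_onI)
      fix j j' assume "j \<in> {0..<dim_col (copies t F)}" "j' \<in> {0..<dim_col (copies t F)}"
        and eq: "\<kappa> (j mod ?n) (j div ?n) = \<kappa> (j' mod ?n) (j' div ?n)"
      then have mem: "(j mod ?n, j div ?n) \<in> {..<?n} \<times> {..<t}"
        "(j' mod ?n, j' div ?n) \<in> {..<?n} \<times> {..<t}"
        using split[of j] split[of j'] by (auto simp: copies_def)
      have "(j mod ?n, j div ?n) = (j' mod ?n, j' div ?n)"
        by (rule inj_onD[OF \<kappa>(2) _ mem]) (simp only: prod.case eq)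
      then show "j = j'"
        by (metis div_mult_mod_eq prod.inject)
    qed
    show "A $$ (\<rho> i, \<kappa> (j mod ?n) (j div ?n)) = copies t F $$ (i, j)"
      if "i < dim_row (copies t F)" "j < dim_col (copies t F)" for i j
      using that entries split[of j] by (simp add: copies_def)
    show "(\<lambda>j. \<kappa> (j mod ?n) (j div ?n)) ` {0..<dim_col (copies t F)} \<subseteq> {0..<dim_col A}"
      using split \<kappa>(1) by (fastforce simp: copies_def)
  qed (use \<rho> in \<open>auto simp: copies_def lessThan_atLeast0\<close>)
qed

lemma simple_mat_imp_simple_on:
  assumes "simple_mat A"
  shows "simple_on (\<lambda>i j. A $$ (i, j)) {0..<dim_row A} {0..<dim_col A}"
  unfolding simple_on_def agree_on_def
proof (intro ballI impI)
  fix j j' assume j: "j \<in> {0..<dim_col A}" "j' \<in> {0..<dim_col A}"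
    and "\<forall>i\<in>{0..<dim_row A}. A $$ (i, j) = A $$ (i, j')"
  then have "col A j = col A j'"
    by (intro eq_vecI) auto
  with j assms show "j = j'"
    unfolding simple_mat_def distinct_conv_nth by (metis atLeastLessThan_iff cols_length cols_nth)
qed

section \<open>Ramsey's theorem and the pigeonhole principle\<close>

lemma ramsey_ordered_pairs:
  fixes C :: "'a set" and n :: nat
  assumes "finite C"
  shows "\<exists>R::nat. \<forall>f. (\<forall>p q. p < q \<longrightarrow> q < R \<longrightarrow> f p q \<in> C) \<longrightarrow>
    (\<exists>h c. h \<in> {..<n} \<rightarrow> {..<R} \<and> strict_mono_on {..<n} h \<and>
      (\<forall>p q. p < q \<longrightarrow> q < n \<longrightarrow> f (h p) (h q) = c))"
proof -
  obtain b where b: "bij_betw b C {0..<card C}"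
    using ex_bij_betw_finite_nat[OF assms] by blast
  obtain R :: nat where R: "partn_lst {..<R} (replicate (card C) n) 2"
    using ramsey_full by blast
  have "\<exists>h c. h \<in> {..<n} \<rightarrow> {..<R} \<and> strict_mono_on {..<n} h \<and>
      (\<forall>p q. p < q \<longrightarrow> q < n \<longrightarrow> f (h p) (h q) = c)"
    if f: "\<And>p q. p < q \<Longrightarrow> q < R \<Longrightarrow> f p q \<in> C" for f :: "nat \<Rightarrow> nat \<Rightarrow> 'a"
  proof -
    let ?g = "\<lambda>e. b (f (Min e) (Max e))"
    have "?g \<in> nsets {..<R} 2 \<rightarrow> {..<card C}"
    proof
      fix e :: "nat set" assume "e \<in> nsets {..<R} 2"
      then obtain x y where "e = {x, y}" "x < y" "y < R"
        by (auto simp: ordered_nsets_2_eq)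
      then show "?g e \<in> {..<card C}"
        using f[of x y] bij_betwE[OF b] by auto
    qed
    then obtain i H where "i < card C" and H: "H \<in> nsets {..<R} n" "?g ` nsets H 2 \<subseteq> {i}"
      using partn_lstE[OF R, of ?g "card C"] by auto
    have fin: "finite H" "card H = n" and sub: "H \<subseteq> {..<R}"
      using H(1) by (auto simp: nsets_def)
    let ?h = "(!) (sorted_list_of_set H)"
    have len: "length (sorted_list_of_set H) = n"
      using fin by simp
    have in_H: "?h p \<in> H" if "p < n" for p
      using that fin len by (metis nth_mem set_sorted_list_of_set)
    have mono: "?h p < ?h q" if "p < q" "q < n" for p q
      using that len by (intro sorted_wrt_nth_less[OF strict_sorted_list_of_set]) auto
    have "f (?h p) (?h q) = the_inv_into C b i" if "p < q" "q < n" for p q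
    proof -
      have "?h p \<in> H" "?h q \<in> H" "?h p < ?h q"
        using that in_H mono by auto
      then have "{?h p, ?h q} \<in> nsets H 2"
        by simp
      then have "?g {?h p, ?h q} = i"
        using H(2) by blast
      then have "b (f (?h p) (?h q)) = i"
        using \<open>?h p < ?h q\<close> by simp
      moreover have "f (?h p) (?h q) \<in> C"
        using f \<open>?h p < ?h q\<close> \<open>?h q \<in> H\<close> sub by blast
      ultimately show ?thesis
        using b by (metis bij_betw_def the_inv_into_f_f)
    qed
    moreover have "?h \<in> {..<n} \<rightarrow> {..<R}"
      using in_H sub by blast
    moreover have "strict_mono_on {..<n} ?h"
      using mono by (auto intro: strict_mono_onI)
    ultimately show ?thesis
      by blast
  qed
  then show ?thesis
    by (intro exI[of _ R]) simp
qed

lemma pigeonhole_copies: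
  assumes f: "f \<in> {..<n} \<rightarrow> B" and "finite B" and "card B * (t - 1) < n"
  obtains b g where "b \<in> B" "inj_on g {..<t}" "\<And>j. j < t \<Longrightarrow> g j < n \<and> f (g j) = b"
proof -
  have "B \<noteq> {}"
    using f assms(3) by force
  then obtain b where b: "b \<in> B" "n \<le> card (f -` {b} \<inter> {..<n}) * card B"
    using pigeonhole_card[OF f] \<open>finite B\<close> by auto
  have "t \<le> card (f -` {b} \<inter> {..<n})"
  proof (rule ccontr)
    assume "\<not> ?thesis"
    then have "card (f -` {b} \<inter> {..<n}) \<le> t - 1"
      by simp
    then have "card (f -` {b} \<inter> {..<n}) * card B \<le> card B * (t - 1)"
      by (simp add: mult.commute)
    with b(2) assms(3) show False
      by simp
  qed
  then obtain g where "inj_on g {..<t}" "g ` {..<t} \<subseteq> f -` {b} \<inter> {..<n}"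
    using card_le_inj[of "{..<t}" "f -` {b} \<inter> {..<n}"] by auto
  then show ?thesis
    using that b(1) by blast
qed

lemma card_distinct_pairs: "card (SIGMA a:{..<r}. {..<r} - {a}) = r * (r - 1)" for r :: nat
  by (subst card_SigmaI) auto

section \<open>Rows whose deletion merges many columns\<close>

text \<open>\<open>D\<close> consists of columns lost on deletion of row \<open>i\<close>. The twins lie outside \<open>D\<close>, so that
  replacing some columns of \<open>D\<close> by their twins cannot produce a column of \<open>D\<close> twice. Several columns
  of \<open>D\<close> may share a twin: a class of \<open>s\<close> merged columns has to count as \<open>s - 1\<close> lost columns,
  because this is the number by which the deletion shrinks the array.\<close>

lemma twins_in_every_row:
  fixes l r t :: nat
  assumes "0 < l"
  defines "N \<equiv> Suc (2 * (r * (r - 1)) * (t - 1))"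
  shows "\<exists>R. \<forall>(A :: 'a \<Rightarrow> 'b \<Rightarrow> nat) M X.
    finite M \<and> R \<le> card M \<and> (\<forall>i\<in>M. \<forall>x\<in>X. A i x < r) \<and> simple_on A M X \<and>
    (\<forall>i\<in>M. \<exists>D\<subseteq>X. card D = N \<and> (\<forall>x\<in>D. \<exists>y\<in>X - D. agree_on A (M - {i}) x y))
    \<longrightarrow> (\<exists>F\<in>T_family l r. repeated_in t F A M X)"
proof -
  let ?C = "{cs. set cs \<subseteq> {..<r} \<times> {..<r} \<times> {..<r} \<times> {..<r} \<and> length cs = N}"
  \<comment> \<open>The colour of a pair records entries on the diagonal for its first row only, so the last of the
    rows found is discarded: hence one more than \<open>2 l\<close>.\<close>
  have "finite ?C"
    by (intro finite_lists_length_eq) auto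
  then obtain R :: nat where R: "\<forall>f. (\<forall>p q. p < q \<longrightarrow> q < R \<longrightarrow> f p q \<in> ?C) \<longrightarrow>
    (\<exists>h c. h \<in> {..<Suc (2 * l)} \<rightarrow> {..<R} \<and> strict_mono_on {..<Suc (2 * l)} h \<and>
      (\<forall>p q. p < q \<longrightarrow> q < Suc (2 * l) \<longrightarrow> f (h p) (h q) = c))"
    using ramsey_ordered_pairs[of ?C "Suc (2 * l)"] by (elim meta_impE exE) (assumption, rule that)
  have "\<exists>F\<in>T_family l r. repeated_in t F A M X"
    if "finite M" "R \<le> card M" and bound: "\<forall>i\<in>M. \<forall>x\<in>X. A i x < r"
      and simple: "simple_on A M X"
      and twins: "\<forall>i\<in>M. \<exists>D\<subseteq>X. card D = N \<and> (\<forall>x\<in>D. \<exists>y\<in>X - D. agree_on A (M - {i}) x y)"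
    for A :: "'a \<Rightarrow> 'b \<Rightarrow> nat" and M X
  proof -
    have "\<exists>x y. inj_on x {..<N} \<and> (\<forall>k<N. x k \<in> X \<and> y k \<in> X \<and> agree_on A (M - {i}) (x k) (y k)) \<and>
        (\<forall>k<N. \<forall>k'<N. x k \<noteq> y k')" if "i \<in> M" for i
    proof -
      obtain D where D: "D \<subseteq> X" "card D = N" "\<forall>x\<in>D. \<exists>y\<in>X - D. agree_on A (M - {i}) x y"
        using twins \<open>i \<in> M\<close> by blast
      then have "finite D"
        by (metis N_def card.infinite nat.distinct(1))
      then obtain x where x: "bij_betw x {0..<N} D"
        using ex_bij_betw_nat_finite D(2) by blast
      then have "\<forall>k<N. \<exists>y. y \<in> X - D \<and> agree_on A (M - {i}) (x k) y"
        using D(3) bij_betwE[OF x] by (metis atLeastLessThan_iff zero_le)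
      then obtain y where y: "\<And>k. k < N \<Longrightarrow> y k \<in> X - D \<and> agree_on A (M - {i}) (x k) (y k)"
        by metis
      have x_D: "x k \<in> D" if "k < N" for k
        using that bij_betwE[OF x] by auto
      have "inj_on x {..<N}"
        using x by (simp add: bij_betw_def lessThan_atLeast0)
      moreover have "\<forall>k<N. x k \<in> X \<and> y k \<in> X \<and> agree_on A (M - {i}) (x k) (y k)"
        using y x_D D(1) by blast
      moreover have "\<forall>k<N. \<forall>k'<N. x k \<noteq> y k'"
      proof (intro allI impI)
        fix k k' assume "k < N" "k' < N"
        then show "x k \<noteq> y k'"
          using x_D[of k] y[of k'] by auto
      qed
      ultimately show ?thesis
        by (rule_tac exI[of _ x], rule_tac exI[of _ y], intro conjI)
    qed
    then obtain x y where *: "\<And>i. i \<in> M \<Longrightarrow> inj_on (x i) {..<N} \<and>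
        (\<forall>k<N. x i k \<in> X \<and> y i k \<in> X \<and> agree_on A (M - {i}) (x i k) (y i k)) \<and>
        (\<forall>k<N. \<forall>k'<N. x i k \<noteq> y i k')"
      by metis
    have inj_x: "inj_on (x i) {..<N}" if "i \<in> M" for i
      using *[OF that] by blast
    have xy: "x i k \<in> X" "y i k \<in> X" "agree_on A (M - {i}) (x i k) (y i k)"
      if "i \<in> M" "k < N" for i k
      using *[OF that(1)] that(2) by blast+
    have x_y: "x i k \<noteq> y i k'" if "i \<in> M" "k < N" "k' < N" for i k k'
      using *[OF that(1)] that(2,3) by blast
    obtain s where s: "bij_betw s {0..<card M} M"
      using ex_bij_betw_nat_finite[OF \<open>finite M\<close>] by blast
    have s_M: "s p \<in> M" if "p < R" for p
      using that \<open>R \<le> card M\<close> bij_betwE[OF s] by auto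
    define f where "f p q = map (\<lambda>k. (A (s q) (x (s p) k), A (s p) (x (s q) k),
      A (s p) (x (s p) k), A (s p) (y (s p) k))) [0..<N]" for p q
    have "\<forall>p q. p < q \<longrightarrow> q < R \<longrightarrow> f p q \<in> ?C"
      using s_M bound xy(1,2) by (auto simp: f_def)
    with R[rule_format, of f] obtain h c where h: "h \<in> {..<Suc (2 * l)} \<rightarrow> {..<R}"
        "strict_mono_on {..<Suc (2 * l)} h"
      and c: "\<And>p q. p < q \<Longrightarrow> q < Suc (2 * l) \<Longrightarrow> f (h p) (h q) = c"
      by blast
    have h_R: "h p < R" if "p \<le> 2 * l" for p
      using that h(1) by (auto simp: Pi_iff)
    define \<sigma> where "\<sigma> p = s (h p)" for p
    have \<sigma>_M: "\<sigma> p \<in> M" if "p \<le> 2 * l" for p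
      unfolding \<sigma>_def using h_R[OF that] by (rule s_M)
    have "inj_on h {..<Suc (2 * l)}"
      using h(2) by (rule strict_mono_on_imp_inj_on)
    moreover have "inj_on s (h ` {..<Suc (2 * l)})"
    proof (rule inj_on_subset[OF bij_betw_imp_inj_on[OF s]])
      show "h ` {..<Suc (2 * l)} \<subseteq> {0..<card M}"
        using less_le_trans[OF h_R \<open>R \<le> card M\<close>] by (auto simp: less_Suc_eq_le)
    qed
    ultimately have "inj_on (s \<circ> h) {..<Suc (2 * l)}"
      by (rule comp_inj_on)
    then have inj_\<sigma>: "inj_on \<sigma> {..<2 * l}"
      unfolding \<sigma>_def comp_def by (rule inj_on_subset) auto

    define u v d e where "u k = fst (c ! k)" and "v k = fst (snd (c ! k))"
      and "d k = fst (snd (snd (c ! k)))" and "e k = snd (snd (snd (c ! k)))" for k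
    have c_nth: "c ! k = (A (\<sigma> q) (x (\<sigma> p) k), A (\<sigma> p) (x (\<sigma> q) k),
        A (\<sigma> p) (x (\<sigma> p) k), A (\<sigma> p) (y (\<sigma> p) k))"
      if "p < q" "q \<le> 2 * l" "k < N" for p q k
      using that c[of p q] unfolding f_def \<sigma>_def by (auto simp: less_Suc_eq_le)
    have u: "A (\<sigma> q) (x (\<sigma> p) k) = u k" and v: "A (\<sigma> p) (x (\<sigma> q) k) = v k"
      if "p < q" "q < 2 * l" "k < N" for p q k
      using c_nth[of p q k] that by (simp_all add: u_def v_def)
    have d: "A (\<sigma> p) (x (\<sigma> p) k) = d k" and e: "A (\<sigma> p) (y (\<sigma> p) k) = e k"
      if "p < 2 * l" "k < N" for p k
      using c_nth[of p "2 * l" k] that by (simp_all add: d_def e_def)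

    have l: "0 < 2 * l"
      using assms by simp
    have bounds: "u k < r" "v k < r" "d k < r" "e k < r" if "k < N" for k
      using c_nth[of 0 "2 * l" k] that l bound \<sigma>_M[of 0] \<sigma>_M[of "2 * l"] xy(1,2)
      by (simp_all add: u_def v_def d_def e_def)
    have simpleD: "a = b" if "i \<in> M" "a \<in> X" "b \<in> X" "agree_on A (M - {i}) a b" "A i a = A i b"
      for a b i
      using that simple unfolding simple_on_def agree_on_def by blast
    have d_e: "d k \<noteq> e k" if "k < N" for k
      using simpleD[of "\<sigma> 0" "x (\<sigma> 0) k" "y (\<sigma> 0) k"] that l \<sigma>_M[of 0] xy x_y d[of 0 k] e[of 0 k]
      by auto
    define w where "w k = (if d k = u k then e k else d k)" for k
    define z where "z p k = (if d k = u k then y (\<sigma> p) k else x (\<sigma> p) k)" for p k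
    have w: "w k < r" "w k \<noteq> u k" if "k < N" for k
      using bounds[OF that] d_e[OF that] by (auto simp: w_def)
    have z_X: "z p k \<in> X" if "p < 2 * l" "k < N" for p k
      using that xy \<sigma>_M by (simp add: z_def)
    have z_diag: "A (\<sigma> p) (z p k) = w k" if "p < 2 * l" "k < N" for p k
      using that d e by (simp add: z_def w_def)
    have z_off: "A (\<sigma> q) (z p k) = u k"
      if "p < 2 * l" "q < 2 * l" "p \<noteq> q" "k < N" "u k = v k" for p q k
    proof -
      have "\<sigma> q \<in> M - {\<sigma> p}"
        using that \<sigma>_M inj_onD[OF inj_\<sigma>, of q p] by auto
      then have "A (\<sigma> q) (y (\<sigma> p) k) = A (\<sigma> q) (x (\<sigma> p) k)"
        using xy(3)[of "\<sigma> p" k] that \<sigma>_M by (simp add: agree_on_def)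
      then have "A (\<sigma> q) (z p k) = A (\<sigma> q) (x (\<sigma> p) k)"
        by (simp add: z_def)
      also have "\<dots> = u k"
        using that u[of p q k] v[of q p k] by (cases p q rule: linorder_cases) auto
      finally show ?thesis .
    qed
    \<comment> \<open>Two lost columns with a common twin differ in row \<open>\<sigma> p\<close>, so at most one of them carries the
      off-diagonal symbol there and is replaced by the twin.\<close>
    have z_inj: "k = k'" if "p < 2 * l" "k < N" "k' < N" "u k = u k'" "z p k = z p k'" for p k k'
    proof (cases "d k = u k \<and> d k' = u k'")
      case True
      then have "agree_on A (M - {\<sigma> p}) (x (\<sigma> p) k) (x (\<sigma> p) k')"
        using that xy(3)[of "\<sigma> p" k] xy(3)[of "\<sigma> p" k'] \<sigma>_M[of p]
        by (simp add: z_def agree_on_def)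
      then have "x (\<sigma> p) k = x (\<sigma> p) k'"
        using simpleD[of "\<sigma> p"] that True \<sigma>_M[of p] xy(1) d[of p k] d[of p k'] by simp
      then show ?thesis
        using that \<sigma>_M[of p] inj_onD[OF inj_x] by simp
    next
      case False
      then have "x (\<sigma> p) k = x (\<sigma> p) k'"
        using that x_y[of "\<sigma> p" k k'] x_y[of "\<sigma> p" k' k] \<sigma>_M[of p]
        by (auto simp: z_def split: if_splits)
      then show ?thesis
        using that \<sigma>_M[of p] inj_onD[OF inj_x] by simp
    qed

    let ?P = "SIGMA a:{..<r}. {..<r} - {a}"
    \<comment> \<open>\<open>True\<close> stands for \<open>I_mat\<close> and \<open>False\<close> for \<open>T_mat\<close>, each followed by its two symbols.\<close>
    define target where "target k = (if u k = v k then (True, w k, u k) else (False, u k, v k))" for k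
    have in_P: "target \<in> {..<N} \<rightarrow> UNIV \<times> ?P"
      using bounds w w(2)[symmetric] by (auto simp: target_def)
    have few_targets: "card ((UNIV :: bool set) \<times> ?P) * (t - 1) < N"
      by (simp add: card_cartesian_product card_distinct_pairs N_def del: card_SigmaI)
    have "finite ((UNIV :: bool set) \<times> ?P)"
      by simp
    from pigeonhole_copies[OF in_P this few_targets]
    obtain b g where b: "b \<in> UNIV \<times> ?P" and inj_g: "inj_on g {..<t}"
      and g: "\<And>j. j < t \<Longrightarrow> g j < N \<and> target (g j) = b"
      by metis
    obtain kind a a' where b_eq: "b = (kind, a, a')"
      by (cases b)
    with b have a: "a < r" "a' < r" "a \<noteq> a'"
      by auto
    show ?thesis
    proof (cases kind)
      case True
      have g': "g j < N" "u (g j) = v (g j)" "w (g j) = a" "u (g j) = a'" if "j < t" for j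
        using g[OF that] True b_eq by (auto simp: target_def split: if_splits)
      have "repeated_in t (I_mat l a a') A M X"
      proof (rule repeated_I_mat[of \<sigma> _ _ _ _ _ "\<lambda>p j. z p (g j)"])
        show "inj_on (\<lambda>j. z p (g j)) {..<t}" if "p < l" for p
        proof (rule inj_onI)
          fix j j' assume "j \<in> {..<t}" "j' \<in> {..<t}" "z p (g j) = z p (g j')"
          then show "j = j'"
            using z_inj[of p "g j" "g j'"] that g'[of j] g'[of j'] inj_onD[OF inj_g, of j j'] by auto
        qed
        show "inj_on \<sigma> {..<l}"
          using inj_\<sigma> by (rule inj_on_subset) auto
      qed (use a g' \<sigma>_M z_X z_diag z_off in auto)
      moreover have "I_mat l a a' \<in> T_family l r"
        using a by (auto simp: T_family_def)
      ultimately show ?thesis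
        by blast
    next
      case False
      have g': "g j < N" "u (g j) = a" "v (g j) = a'" if "j < t" for j
        using g[OF that] False b_eq by (auto simp: target_def split: if_splits)
      have "repeated_in t (T_mat l a a') A M X"
      proof (rule repeated_T_mat[of \<sigma> _ _ _ _ _ "\<lambda>p j. x (\<sigma> p) (g j)"])
        show "inj_on (\<lambda>j. x (\<sigma> p) (g j)) {..<t}" if "p < 2 * l" for p
        proof (rule inj_onI)
          fix j j' assume "j \<in> {..<t}" "j' \<in> {..<t}" "x (\<sigma> p) (g j) = x (\<sigma> p) (g j')"
          then show "j = j'"
            using that g'(1)[of j] g'(1)[of j'] inj_onD[OF inj_g, of j j']
              inj_onD[OF inj_x, of "\<sigma> p" "g j" "g j'"] \<sigma>_M[of p] by auto
        qed
      qed (use a g' \<sigma>_M xy(1) u v inj_\<sigma> in auto)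
      moreover have "T_mat l a a' \<in> T_family l r"
        using a by (auto simp: T_family_def)
      ultimately show ?thesis
        by blast
    qed
  qed
  then show ?thesis
    by blast
qed

section \<open>Deleting a row\<close>

lemma keep_one_per_class:
  obtains X' where "X' \<subseteq> X" "simple_on A M X'" "\<And>x. x \<in> X \<Longrightarrow> \<exists>y\<in>X'. agree_on A M x y"
proof -
  let ?f = "\<lambda>x. restrict (\<lambda>i. A i x) M"
  have eq: "?f x = ?f y \<longleftrightarrow> agree_on A M x y" for x y
    by (auto simp: agree_on_def fun_eq_iff restrict_def)
  obtain X' where "X' \<subseteq> X" "inj_on ?f X'" "?f ` X = ?f ` X'"
    using subset_image_inj[of "?f ` X" ?f X] by auto
  moreover have "simple_on A M X'"
    using \<open>inj_on ?f X'\<close> unfolding simple_on_def inj_on_def eq by blast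
  moreover have "\<exists>y\<in>X'. agree_on A M x y" if "x \<in> X" for x
  proof -
    have "?f x \<in> ?f ` X'"
      using that unfolding \<open>?f ` X = ?f ` X'\<close>[symmetric] by (rule imageI)
    then obtain y where "y \<in> X'" "?f x = ?f y"
      by (rule imageE)
    then show ?thesis
      using eq by blast
  qed
  ultimately show ?thesis
    using that by blast
qed

lemma card_simple_on:
  fixes A :: "'a \<Rightarrow> 'b \<Rightarrow> nat"
  assumes "finite M" "simple_on A M X" "\<And>i x. i \<in> M \<Longrightarrow> x \<in> X \<Longrightarrow> A i x < r"
  shows "card X \<le> r ^ card M"
proof -
  let ?f = "\<lambda>x. restrict (\<lambda>i. A i x) M"
  have "inj_on ?f X"
    using assms(2) unfolding simple_on_def inj_on_def agree_on_def
    by (metis restrict_apply')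
  moreover have "?f ` X \<subseteq> M \<rightarrow>\<^sub>E {..<r}"
    using assms(3) by auto
  ultimately have "card X \<le> card (M \<rightarrow>\<^sub>E {..<r})"
    using assms(1) by (intro card_inj_on_le[of ?f]) (auto intro: finite_PiE)
  then show ?thesis
    using assms(1) by (simp add: card_PiE)
qed

section \<open>The linear bound\<close>

lemma linear_bound_avoiding_repeated:
  fixes l r t :: nat
  assumes "0 < l" "0 < r"
  shows "\<exists>R. \<forall>(A :: 'a \<Rightarrow> 'b \<Rightarrow> nat) M X.
    finite M \<and> finite X \<and> (\<forall>i\<in>M. \<forall>x\<in>X. A i x < r) \<and> simple_on A M X \<and>
    (\<forall>F\<in>T_family l r. \<not> repeated_in t F A M X)
    \<longrightarrow> card X \<le> 2 * (r * (r - 1)) * (t - 1) * card M + r ^ R"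
proof -
  let ?K = "2 * (r * (r - 1)) * (t - 1)"
  obtain R where R: "\<forall>(A :: 'a \<Rightarrow> 'b \<Rightarrow> nat) M X.
      finite M \<and> R \<le> card M \<and> (\<forall>i\<in>M. \<forall>x\<in>X. A i x < r) \<and> simple_on A M X \<and>
      (\<forall>i\<in>M. \<exists>D\<subseteq>X. card D = Suc ?K \<and> (\<forall>x\<in>D. \<exists>y\<in>X - D. agree_on A (M - {i}) x y))
      \<longrightarrow> (\<exists>F\<in>T_family l r. repeated_in t F A M X)"
    using twins_in_every_row[OF assms(1), where r = r and t = t] by blast
  have "card X \<le> ?K * card M + r ^ R"
    if "finite M" "finite X" "\<forall>i\<in>M. \<forall>x\<in>X. A i x < r"
      "simple_on A M X" "\<forall>F\<in>T_family l r. \<not> repeated_in t F A M X"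
    for A :: "'a \<Rightarrow> 'b \<Rightarrow> nat" and M X
    using that
  proof (induction "card M" arbitrary: M X rule: less_induct)
    case less
    note bound = less.prems(3)
    show ?case
    proof (cases "card M < R")
      case True
      have "card X \<le> r ^ card M"
        using less.prems card_simple_on by blast
      also have "\<dots> \<le> r ^ R"
        using True \<open>0 < r\<close> by (intro power_increasing) auto
      finally show ?thesis
        by simp
    next
      case False
      have "\<not> (\<forall>i\<in>M. \<exists>D\<subseteq>X. card D = Suc ?K \<and> (\<forall>x\<in>D. \<exists>y\<in>X - D. agree_on A (M - {i}) x y))"
      proof
        assume "\<forall>i\<in>M. \<exists>D\<subseteq>X. card D = Suc ?K \<and> (\<forall>x\<in>D. \<exists>y\<in>X - D. agree_on A (M - {i}) x y)"
        then have "\<exists>F\<in>T_family l r. repeated_in t F A M X"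
          using False less.prems by (intro R[rule_format] conjI) auto
        with less.prems(5) show False
          by blast
      qed
      then obtain i where "i \<in> M" and few: "\<And>D. D \<subseteq> X \<Longrightarrow> card D = Suc ?K \<Longrightarrow>
          \<not> (\<forall>x\<in>D. \<exists>y\<in>X - D. agree_on A (M - {i}) x y)"
        by blast
      obtain X' where X': "X' \<subseteq> X" "simple_on A (M - {i}) X'"
          "\<And>x. x \<in> X \<Longrightarrow> \<exists>y\<in>X'. agree_on A (M - {i}) x y"
        using keep_one_per_class[of X A "M - {i}"] by blast
      have "card (X - X') \<le> ?K"
      proof (rule ccontr)
        assume "\<not> ?thesis"
        then obtain D where D: "D \<subseteq> X - X'" "card D = Suc ?K"
          by (meson not_less_eq_eq obtain_subset_with_card_n)
        then have "\<forall>x\<in>D. \<exists>y\<in>X - D. agree_on A (M - {i}) x y"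
          using X' by blast
        with few[of D] D show False
          by blast
      qed
      moreover have "card X' \<le> ?K * card (M - {i}) + r ^ R"
      proof (rule less.hyps)
        show "card (M - {i}) < card M"
          using \<open>i \<in> M\<close> less.prems(1) by (rule_tac card_Diff1_less)
        show "\<forall>F\<in>T_family l r. \<not> repeated_in t F A (M - {i}) X'"
          using less.prems(5) that repeated_in_mono[of t _ A "M - {i}" X' M X] X'(1) by blast
      qed (use less.prems X' bound in \<open>auto intro: finite_subset\<close>)
      moreover have "card X = card X' + card (X - X')"
        using X'(1) less.prems(2) by (metis card_Diff_subset card_mono finite_subset le_add_diff_inverse)
      moreover have "card M = Suc (card (M - {i}))"
        using less.prems(1) \<open>i \<in> M\<close> by (rule card.remove)
      ultimately show ?thesis
        by simp
    qed
  qed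
  then show ?thesis
    by blast
qed

theorem theorem1p4:
  fixes l r t :: nat
  assumes "l \<ge> 2" and "r \<ge> 2" and "t \<ge> 1"
  shows "\<exists>c::real. \<forall>m::nat. m \<ge> 1 \<longrightarrow>
    real (forb m r (copies_family t (T_family l r)))
      \<le> 2 * real r * (real r - 1) * (real t - 1) * real m + c"
proof -
  let ?K = "2 * (r * (r - 1)) * (t - 1)" and ?G = "copies_family t (T_family l r)"
  obtain R where R: "\<forall>(A :: nat \<Rightarrow> nat \<Rightarrow> nat) M X.
      finite M \<and> finite X \<and> (\<forall>i\<in>M. \<forall>x\<in>X. A i x < r) \<and> simple_on A M X \<and>
      (\<forall>F\<in>T_family l r. \<not> repeated_in t F A M X) \<longrightarrow> card X \<le> ?K * card M + r ^ R"
    using linear_bound_avoiding_repeated[where r = r and l = l and t = t] assms(1,2) by auto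
  have "dim_col A \<le> ?K * m + r ^ R" if "A \<in> avoiding m r ?G" for A m
  proof -
    have A: "dim_row A = m" "elements_mat A \<subseteq> {0..<r}" "simple_mat A"
      and no: "\<And>F. F \<in> T_family l r \<Longrightarrow> \<not> copies t F \<prec>\<^sub>c A"
      using that by (auto simp: avoiding_def r_matrix_def copies_family_def)
    have "card {0..<dim_col A} \<le> ?K * card {0..<dim_row A} + r ^ R"
    proof (rule R[rule_format, where A = "\<lambda>i j. A $$ (i, j)"], intro conjI)
      show "\<forall>i\<in>{0..<dim_row A}. \<forall>j\<in>{0..<dim_col A}. A $$ (i, j) < r"
        using A(2) by (fastforce simp: elements_mat_def)
      show "\<forall>F\<in>T_family l r. \<not> repeated_in t F (\<lambda>i j. A $$ (i, j)) {0..<dim_row A} {0..<dim_col A}"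
        using no repeated_in_imp_configuration by blast
      show "simple_on (\<lambda>i j. A $$ (i, j)) {0..<dim_row A} {0..<dim_col A}"
        using A(3) by (rule simple_mat_imp_simple_on)
    qed simp_all
    then show ?thesis
      using A(1) by simp
  qed
  moreover have "avoiding m r ?G \<noteq> {}" for m
    using assms by (intro avoiding_nonempty)
      (auto simp: copies_family_def copies_def T_family_def I_mat_def T_mat_def)
  ultimately have "forb m r ?G \<le> ?K * m + r ^ R" for m
    unfolding forb_def using finite_avoiding by (subst Max_le_iff) auto
  then have "real (forb m r ?G) \<le> real (?K * m + r ^ R)" for m
    using of_nat_le_iff by blast
  moreover have "real (?K * m + r ^ R) =
      2 * real r * (real r - 1) * (real t - 1) * real m + real (r ^ R)" for m
    using assms by (simp add: of_nat_diff)
  ultimately show ?thesis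
    by metis
qed

end
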